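(* Let $\mathscr{X}_{2.1}$ be the set of digraphs $D$ with $S_D\mathbf{1} > \mathbf{0}$, and let $\mathscr{X}_{2.3}$ be the set of digraphs $D$ for which there is no non-zero weight vector $\mathbf{w}$ on $D$ with $S_D\mathbf{w}\leq\mathbf{0}$. Then every minimal member of $\mathscr{X}_{2.3}$ is smaller than every minimal member of $\mathscr{X}_{2.1}$; that is, it has strictly fewer arcs.
   Context: A digraph is a finite directed graph with at least one vertex whose underlying graph is simple, i.e. it has no loops and there is at most one arc between any two distinct vertices (in particular no pair of opposite arcs). For vertices $u,v$ of a digraph $D$, $d(u,v)$ is the length of a shortest directed path from $u$ to $v$ in $D$ (with $d(u,v)=\infty$ if there is none). If $V(D)=\{v_1,\dots,v_n\}$, the second-neighborhood matrix $S_D=(s_{ij})$ is the $n\times n$ real matrix with $s_{ij}=1$ if $d(v_i,v_j)=1$, $s_{ij}=-1$ if $d(v_i,v_j)=2$, and $s_{ij}=0$ otherwise. A weight vector on $D$ is a real vector indexed by $V(D)$ with all components in $[0,\infty)$. $\mathbf{0}$ and $\mathbf{1}$ denote the all-zeros and all-ones vectors. For vectors, $\mathbf{u}\leq\mathbf{v}$ and $\mathbf{u}>\mathbf{v}$ mean that the relation holds in every component. The words "minimal" and "smaller" refer to the number of arcs: a member of a set of digraphs is minimal if no member of that set has fewer arcs. *)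

theory Defs
  imports Complex_Main "HOL-Library.Extended_Nat" "HOL-Library.Infinite_Typeclass"
    "Graph_Theory.Pair_Digraph"
begin

text \<open>
  Finite digraphs with at least one vertex whose underlying graph is simple.  Finiteness,
  well-formedness and the absence of loops are part of \<^locale>\<open>pair_digraph\<close>; parallel arcs
  cannot occur since arcs are pairs of vertices.
\<close>

locale oriented_digraph = pair_digraph +
  assumes verts_nonempty: "pverts G \<noteq> {}"
    and no_opposite_arcs: "(u, v) \<in> parcs G \<Longrightarrow> (v, u) \<notin> parcs G"

text \<open>The infimum of the empty set is \<open>\<infinity>\<close>; the lists \<open>p\<close> are lists of arcs.\<close>

definition distance :: "'a pair_pre_digraph \<Rightarrow> 'a \<Rightarrow> 'a \<Rightarrow> enat" where
  "distance D u v = (INF p\<in>{p. pre_digraph.apath (with_proj D) u p v}. enat (length p))"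

text \<open>
  Matrices and vectors of a digraph are indexed by its vertices, without choosing an enumeration
  of them; only their entries at vertices of the digraph are meaningful.
\<close>

definition second_nbhd_matrix :: "'a pair_pre_digraph \<Rightarrow> 'a \<Rightarrow> 'a \<Rightarrow> real" where
  "second_nbhd_matrix D u v =
    (if distance D u v = 1 then 1 else if distance D u v = 2 then -1 else 0)"

definition second_nbhd_mult :: "'a pair_pre_digraph \<Rightarrow> ('a \<Rightarrow> real) \<Rightarrow> 'a \<Rightarrow> real" where
  "second_nbhd_mult D w u = (\<Sum>v\<in>pverts D. second_nbhd_matrix D u v * w v)"

definition weight_vector :: "'a pair_pre_digraph \<Rightarrow> ('a \<Rightarrow> real) \<Rightarrow> bool" where
  "weight_vector D w \<longleftrightarrow> (\<forall>v\<in>pverts D. 0 \<le> w v)"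

definition X_2_1 :: "'a pair_pre_digraph set" where
  "X_2_1 = {D. oriented_digraph D \<and> (\<forall>u\<in>pverts D. second_nbhd_mult D (\<lambda>_. 1) u > 0)}"

definition X_2_3 :: "'a pair_pre_digraph set" where
  "X_2_3 = {D. oriented_digraph D \<and>
    \<not> (\<exists>w. weight_vector D w \<and> (\<exists>v\<in>pverts D. w v \<noteq> 0) \<and>
          (\<forall>u\<in>pverts D. second_nbhd_mult D w u \<le> 0))}"

definition num_arcs :: "'a pair_pre_digraph \<Rightarrow> nat" where
  "num_arcs D = card (parcs D)"

definition minimal_member :: "'a pair_pre_digraph set \<Rightarrow> 'a pair_pre_digraph \<Rightarrow> bool" where
  "minimal_member X D \<longleftrightarrow> is_arg_min num_arcs (\<lambda>D'. D' \<in> X) D"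

end

theory Submission
  imports Defs "Jordan_Normal_Form.Determinant"
begin

text \<open>
  If \<open>y \<ge> 0\<close> satisfies \<open>S\<^sub>F y > 0\<close>, then no non-zero weight vector \<open>w\<close> satisfies
  \<open>S w \<le> 0\<close> for the reverse of \<open>F\<close>, whose matrix \<open>S\<close> is the transpose of \<open>S\<^sub>F\<close>. So suppose that
  \<open>S\<^sub>E 1 > 0\<close> and that no digraph \<open>F\<close> with fewer arcs than \<open>E\<close> has such a weight \<open>y\<close>. Deleting a
  vertex of weight \<open>0\<close> never hurts, hence \<open>S\<^sub>E w > 0\<close> forces \<open>w > 0\<close>; therefore \<open>S\<^sub>E\<close> is invertible
  with non-negative inverse \<open>R\<close>, and the row sums of \<open>R\<close> are at most \<open>1\<close> because the entries of
  \<open>S\<^sub>E 1\<close> are positive integers. Deleting an arc \<open>(u, v)\<close> hurts only the entry \<open>u\<close> of \<open>S\<^sub>E w\<close>, by at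
  most \<open>2 w(v)\<close>; for \<open>w\<close> the column \<open>u\<close> of \<open>R\<close> this yields \<open>R(v, u) \<ge> 1 / 2\<close>. So all in-degrees are
  at most \<open>2\<close>, some out-degree is at most \<open>2\<close>, and a vertex of minimal out-degree
  gives a contradiction.
\<close>

section \<open>Linear algebra over a finite index set\<close>

text \<open>An enumeration of \<open>V\<close> turns \<open>A\<close> into a square matrix;
  injectivity makes its determinant non-zero, and the adjugate then solves the system.\<close>

lemma injective_imp_surjective_on_finite:
  fixes A :: "'a \<Rightarrow> 'a \<Rightarrow> 'b::field"
  assumes fin: "finite V"
    and inj: "\<And>z. (\<And>u. u \<in> V \<Longrightarrow> (\<Sum>v\<in>V. A u v * z v) = 0) \<Longrightarrow> (\<And>v. v \<in> V \<Longrightarrow> z v = 0)"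
  obtains z where "\<And>u. u \<in> V \<Longrightarrow> (\<Sum>v\<in>V. A u v * z v) = b u"
proof -
  define n where "n = card V"
  obtain h where h: "bij_betw h {0..<n} V"
    using ex_bij_betw_nat_finite[OF fin] unfolding n_def by blast
  define k where "k = the_inv_into {0..<n} h"
  have hV: "h i \<in> V" if "i < n" for i using h that by (auto simp: bij_betw_def)
  have kh: "k (h i) = i" if "i < n" for i
    using h that unfolding k_def by (auto simp: bij_betw_def the_inv_into_f_f)
  have hk: "h (k v) = v" "k v < n" if "v \<in> V" for v
    using h that f_the_inv_into_f[of h "{0..<n}" v] the_inv_into_into[of h "{0..<n}" v "{0..<n}"]
    unfolding k_def by (auto simp: bij_betw_def)
  define M where "M = mat n n (\<lambda>(i, j). A (h i) (h j))"
  have M: "M \<in> carrier_mat n n" unfolding M_def by simp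
  have M_mult: "(\<Sum>v\<in>V. A u v * x $ k v) = (M *\<^sub>v x) $ k u"
    if "u \<in> V" "x \<in> carrier_vec n" for u x
  proof -
    have "(\<Sum>v\<in>V. A u v * x $ k v) = (\<Sum>j\<in>{0..<n}. A u (h j) * x $ k (h j))"
      by (rule sum.reindex_bij_betw[OF h, symmetric])
    also have "\<dots> = (\<Sum>j\<in>{0..<n}. A (h (k u)) (h j) * x $ j)"
      using that by (intro sum.cong) (auto simp: kh hk)
    also have "\<dots> = (M *\<^sub>v x) $ k u"
      using that hk[OF that(1)] unfolding M_def by (auto simp: scalar_prod_def)
    finally show ?thesis .
  qed
  have "det M \<noteq> 0"
  proof
    assume "det M = 0"
    then obtain x where x: "x \<in> carrier_vec n" "x \<noteq> 0\<^sub>v n" "M *\<^sub>v x = 0\<^sub>v n"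
      using det_0_iff_vec_prod_zero[OF M] by blast
    have "x $ k v = 0" if "v \<in> V" for v
    proof (rule inj[OF _ that, of "\<lambda>v. x $ k v"])
      fix u assume "u \<in> V"
      then show "(\<Sum>v\<in>V. A u v * x $ k v) = 0" using M_mult[of u x] x hk(2)[of u] by simp
    qed
    then have "x $ i = 0" if "i < n" for i using that hV kh by metis
    then have "x = 0\<^sub>v n" using x(1) by (intro eq_vecI) auto
    then show False using x(2) by simp
  qed
  define y where "y = vec n (\<lambda>i. b (h i))"
  define x where "x = adj_mat M *\<^sub>v ((1 / det M) \<cdot>\<^sub>v y)"
  note adj = adj_mat[OF M]
  have y: "y \<in> carrier_vec n" unfolding y_def by simp
  have x: "x \<in> carrier_vec n" unfolding x_def using adj(1) y by auto
  have "M *\<^sub>v x = (M * adj_mat M) *\<^sub>v ((1 / det M) \<cdot>\<^sub>v y)"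
    unfolding x_def using M adj(1) y by (intro assoc_mult_mat_vec[symmetric]) auto
  also have "\<dots> = y"
    unfolding adj(2) using y \<open>det M \<noteq> 0\<close>
    by (intro eq_vecI) (auto simp: scalar_prod_def if_distrib[of "\<lambda>c. c * _"] cong: if_cong)
  finally have "M *\<^sub>v x = y" .
  then have "(\<Sum>v\<in>V. A u v * x $ k v) = b u" if "u \<in> V" for u
    using M_mult[OF that x] that hk[OF that] unfolding y_def by simp
  then show ?thesis by (rule that)
qed

section \<open>Distances and matrix entries in terms of arcs\<close>

text \<open>A finite infimum rules out the empty set of paths and is attained, since
  \<open>enat\<close> is well-ordered.\<close>

lemma distance_eq_enat_iff:
  "distance D u v = enat n \<longleftrightarrow>
    (\<exists>p. pre_digraph.apath (with_proj D) u p v \<and> length p = n) \<and>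
    (\<forall>p. pre_digraph.apath (with_proj D) u p v \<longrightarrow> n \<le> length p)"
  (is "_ \<longleftrightarrow> ?R")
proof
  let ?P = "\<lambda>p. pre_digraph.apath (with_proj D) u p v"
  assume d: "distance D u v = enat n"
  have lower: "enat n \<le> enat (length p)" if "?P p" for p
    unfolding d[symmetric] distance_def using that by (intro INF_lower) simp
  have "{p. ?P p} \<noteq> {}"
    using d unfolding distance_def by (auto simp: Inf_enat_def simp del: Collect_empty_eq)
  then have "distance D u v \<in> (\<lambda>p. enat (length p)) ` {p. ?P p}"
    unfolding distance_def Inf_enat_def by (auto intro: LeastI)
  then show ?R using d lower by auto
next
  assume ?R
  then show "distance D u v = enat n"
    unfolding distance_def by (intro antisym INF_greatest) (auto intro: INF_lower2)
qed

lemma second_nbhd_matrix_eq: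
  assumes "oriented_digraph D"
  shows "second_nbhd_matrix D u v =
    (if (u, v) \<in> parcs D then 1
     else if u \<noteq> v \<and> (\<exists>w. (u, w) \<in> parcs D \<and> (w, v) \<in> parcs D) then -1 else 0)"
proof -
  interpret oriented_digraph D by fact
  have len0: "(\<exists>p. apath u p v \<and> length p = 0) \<longleftrightarrow> u = v \<and> u \<in> pverts D"
    by (auto simp: apath_Nil_iff)
  have len1: "(\<exists>p. apath u p v \<and> length p = 1) \<longleftrightarrow> (u, v) \<in> parcs D"
    using wellformed' pair_no_loops by (force simp: length_Suc_conv apath_simps)
  have len2: "(\<exists>p. apath u p v \<and> length p = 2) \<longleftrightarrow>
      u \<noteq> v \<and> (\<exists>w. (u, w) \<in> parcs D \<and> (w, v) \<in> parcs D)"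
  proof
    assume "\<exists>p. apath u p v \<and> length p = 2"
    then obtain e f where "apath u [e, f] v"
      by (auto simp: numeral_2_eq_2 length_Suc_conv)
    then show "u \<noteq> v \<and> (\<exists>w. (u, w) \<in> parcs D \<and> (w, v) \<in> parcs D)"
      by (cases e; cases f) (auto simp: apath_simps)
  next
    assume "u \<noteq> v \<and> (\<exists>w. (u, w) \<in> parcs D \<and> (w, v) \<in> parcs D)"
    then obtain w where w: "u \<noteq> v" "(u, w) \<in> parcs D" "(w, v) \<in> parcs D" by blast
    then have "apath u [(u, w), (w, v)] v"
      using pair_no_loops[OF w(2)] pair_no_loops[OF w(3)] in_arcsD2[OF w(3)]
      by (auto simp: apath_simps)
    then show "\<exists>p. apath u p v \<and> length p = 2"
      by (metis One_nat_def Suc_1 length_Cons list.size(3))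
  qed
  have le1: "1 \<le> n \<longleftrightarrow> n \<noteq> 0" and le2: "2 \<le> n \<longleftrightarrow> n \<noteq> 0 \<and> n \<noteq> 1" for n :: nat by auto
  have "distance D u v = 1 \<longleftrightarrow> (u, v) \<in> parcs D"
    using len0 len1 pair_no_loops[of "(u, v)"]
    unfolding one_enat_def distance_eq_enat_iff le1 by auto
  moreover have "distance D u v = 2 \<longleftrightarrow>
      (u, v) \<notin> parcs D \<and> u \<noteq> v \<and> (\<exists>w. (u, w) \<in> parcs D \<and> (w, v) \<in> parcs D)"
    using len0 len1 len2
    unfolding numeral_eq_enat distance_eq_enat_iff le2 by auto
  ultimately show ?thesis unfolding second_nbhd_matrix_def by auto
qed

text \<open>Losing arcs can only destroy two-step paths, which raises \<open>-1\<close> to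
  \<open>0\<close>; an entry can drop only where the arc itself is lost.\<close>

lemma second_nbhd_matrix_mono:
  assumes "oriented_digraph D" "oriented_digraph D'" "parcs D' \<subseteq> parcs D"
    and "(u, v) \<in> parcs D \<Longrightarrow> (u, v) \<in> parcs D'"
  shows "second_nbhd_matrix D u v \<le> second_nbhd_matrix D' u v"
  using assms(3,4) by (auto simp: second_nbhd_matrix_eq[OF assms(1)] second_nbhd_matrix_eq[OF assms(2)])

lemma oriented_digraph_subgraph:
  assumes "oriented_digraph D" "V \<subseteq> pverts D" "V \<noteq> {}" "A \<subseteq> parcs D" "A \<subseteq> V \<times> V"
  shows "oriented_digraph \<lparr>pverts = V, parcs = A\<rparr>"
proof -
  interpret oriented_digraph D by fact
  show ?thesis
    using assms(2-) finite_subset[OF assms(2) pair_finite_verts]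
      finite_subset[OF assms(4) pair_finite_arcs] no_opposite_arcs pair_no_loops
    by unfold_locales (auto, blast)
qed

section \<open>Reversal and duality\<close>

definition reverse :: "'a pair_pre_digraph \<Rightarrow> 'a pair_pre_digraph" where
  "reverse D = \<lparr>pverts = pverts D, parcs = (parcs D)\<inverse>\<rparr>"

lemma pverts_reverse [simp]: "pverts (reverse D) = pverts D"
  and parcs_reverse [simp]: "parcs (reverse D) = (parcs D)\<inverse>"
  by (simp_all add: reverse_def)

lemma num_arcs_reverse [simp]: "num_arcs (reverse D) = num_arcs D"
  by (simp add: num_arcs_def)

lemma oriented_digraph_reverse:
  assumes "oriented_digraph D"
  shows "oriented_digraph (reverse D)"
proof -
  interpret oriented_digraph D by fact
  show ?thesis
    using arc_fst_in_verts arc_snd_in_verts pair_finite_verts pair_finite_arcs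
      no_opposite_arcs pair_no_loops verts_nonempty
    by unfold_locales fastforce+
qed

lemma second_nbhd_matrix_reverse:
  assumes "oriented_digraph D"
  shows "second_nbhd_matrix (reverse D) u v = second_nbhd_matrix D v u"
  unfolding second_nbhd_matrix_eq[OF assms] second_nbhd_matrix_eq[OF oriented_digraph_reverse[OF assms]]
  by auto

text \<open>
  The easy half of a theorem of the alternative: \<open>y\<close> certifies that no weight vector
  \<open>w\<close> as in the definition of \<^const>\<open>X_2_3\<close> exists.
\<close>

lemma reverse_in_X_2_3:
  assumes D: "oriented_digraph D"
    and y: "weight_vector D y" "\<And>u. u \<in> pverts D \<Longrightarrow> second_nbhd_mult D y u > 0"
  shows "reverse D \<in> X_2_3"
proof -
  interpret oriented_digraph D by fact
  have False if w: "weight_vector (reverse D) w" "v \<in> pverts D" "w v \<noteq> 0"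
    "\<And>u. u \<in> pverts D \<Longrightarrow> second_nbhd_mult (reverse D) w u \<le> 0" for w v
  proof -
    \<comment> \<open>The bilinear form of \<open>w\<close> and \<open>y\<close> is positive when
      summed by rows and non-positive when summed by columns.\<close>
    have "0 < (\<Sum>u\<in>pverts D. w u * second_nbhd_mult D y u)"
      using w y(2) pair_finite_verts
      by (intro sum_pos2[of _ v]) (auto simp: weight_vector_def less_le)
    also have "\<dots> = (\<Sum>x\<in>pverts D. y x * second_nbhd_mult (reverse D) w x)"
      unfolding second_nbhd_mult_def sum_distrib_left
      by (subst sum.swap) (simp add: second_nbhd_matrix_reverse[OF D] mult_ac)
    also have "\<dots> \<le> 0"
      using w(4) y(1) by (intro sum_nonpos) (simp add: weight_vector_def mult_nonneg_nonpos)
    finally show False by simp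
  qed
  then show ?thesis using oriented_digraph_reverse[OF D] unfolding X_2_3_def by auto
qed

section \<open>Linearity and monotonicity of the matrix product\<close>

lemma second_nbhd_mult_linear:
  "second_nbhd_mult D (\<lambda>x. a * f x + b * g x) u =
    a * second_nbhd_mult D f u + b * second_nbhd_mult D g u"
  unfolding second_nbhd_mult_def by (simp add: sum_distrib_left sum.distrib algebra_simps)

lemma second_nbhd_mult_sum:
  "second_nbhd_mult D (\<lambda>x. \<Sum>i\<in>I. f i x) u = (\<Sum>i\<in>I. second_nbhd_mult D (f i) u)"
  unfolding second_nbhd_mult_def sum_distrib_left by (rule sum.swap)

text \<open>Serves the deletion of zero-weight vertices and of arcs alike.\<close>

lemma second_nbhd_mult_mono:
  assumes "finite (pverts D)" "pverts D' \<subseteq> pverts D"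
    and "weight_vector D w" "\<And>v. v \<in> pverts D - pverts D' \<Longrightarrow> w v = 0"
    and "\<And>v. v \<in> pverts D' \<Longrightarrow> second_nbhd_matrix D u v \<le> second_nbhd_matrix D' u v"
  shows "second_nbhd_mult D w u \<le> second_nbhd_mult D' w u"
proof -
  have "second_nbhd_mult D w u = (\<Sum>v\<in>pverts D'. second_nbhd_matrix D u v * w v)"
    unfolding second_nbhd_mult_def using assms by (intro sum.mono_neutral_right) auto
  also have "\<dots> \<le> second_nbhd_mult D' w u"
    unfolding second_nbhd_mult_def using assms
    by (intro sum_mono mult_right_mono) (auto simp: weight_vector_def)
  finally show ?thesis .
qed

section \<open>Deletion of vertices and arcs in a critical counterexample\<close>

text \<open>The situation to be refuted, with \<open>G\<close> in the role of a minimal member of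
  \<open>X_2_1\<close>.\<close>

locale critical_counterexample = oriented_digraph G for G :: "'a pair_pre_digraph" +
  assumes mult_one_pos: "u \<in> pverts G \<Longrightarrow> second_nbhd_mult G (\<lambda>_. 1) u > 0"
    and num_arcs_le: "\<And>F :: 'a pair_pre_digraph. F \<in> X_2_3 \<Longrightarrow> num_arcs G \<le> num_arcs F"
begin

lemma oriented: "oriented_digraph G"
  by unfold_locales

text \<open>By duality \<open>reverse F\<close> would be a member of \<open>X_2_3\<close> with fewer
  arcs than \<open>G\<close>.\<close>

lemma no_smaller_weighted_counterexample:
  assumes "oriented_digraph F" "parcs F \<subset> parcs G" "weight_vector F w"
    and "\<And>u. u \<in> pverts F \<Longrightarrow> second_nbhd_mult F w u > 0"
  shows False
proof -
  have "reverse F \<in> X_2_3" using reverse_in_X_2_3 assms by blast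
  from num_arcs_le[OF this] psubset_card_mono[OF pair_finite_arcs assms(2)]
  show False by (simp add: num_arcs_def)
qed

text \<open>Deleting a vertex of weight zero keeps all other products positive. Its own positive
  product forces an outgoing arc, so the deletion really loses arcs.\<close>

lemma weight_pos:
  assumes w: "weight_vector G w" "\<And>u. u \<in> pverts G \<Longrightarrow> second_nbhd_mult G w u > 0"
    and v: "v \<in> pverts G"
  shows "w v > 0"
proof (rule ccontr)
  assume "\<not> w v > 0"
  then have wv: "w v = 0" using w(1) v by (force simp: weight_vector_def)
  obtain x where x: "(v, x) \<in> parcs G"
  proof (rule ccontr)
    assume "\<not> thesis"
    then have "\<And>x. (v, x) \<notin> parcs G" using that by blast
    then have "second_nbhd_matrix G v x = 0" for x
      by (simp add: second_nbhd_matrix_eq[OF oriented])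
    then have "second_nbhd_mult G w v = 0" by (simp add: second_nbhd_mult_def)
    with w(2)[OF v] show False by simp
  qed
  define F where "F = \<lparr>pverts = pverts G - {v}, parcs = parcs G \<inter> (pverts G - {v}) \<times> (pverts G - {v})\<rparr>"
  have "x \<noteq> v" "x \<in> pverts G" using pair_no_loops[OF x] in_arcsD2[OF x] by auto
  then have F: "oriented_digraph F"
    unfolding F_def by (intro oriented_digraph_subgraph[OF oriented]) auto
  show False
  proof (rule no_smaller_weighted_counterexample[OF F])
    show "parcs F \<subset> parcs G" unfolding F_def using x by auto
    show "weight_vector F w" using w(1) by (simp add: weight_vector_def F_def)
    fix u assume u: "u \<in> pverts F"
    have "second_nbhd_mult G w u \<le> second_nbhd_mult F w u"
      using u wv w(1) pair_finite_verts
      by (intro second_nbhd_mult_mono second_nbhd_matrix_mono[OF oriented F]) (auto simp: F_def)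
    with w(2)[of u] u show "second_nbhd_mult F w u > 0" by (auto simp: F_def)
  qed
qed

text \<open>Deleting the arc \<open>(u, v)\<close> lowers only the entry \<open>(u, v)\<close> of the matrix, by at most \<open>2\<close>.\<close>

lemma mult_le_twice_weight:
  assumes w: "weight_vector G w" "\<And>u. u \<in> pverts G \<Longrightarrow> second_nbhd_mult G w u > 0"
    and uv: "(u, v) \<in> parcs G"
  shows "second_nbhd_mult G w u \<le> 2 * w v"
proof (rule ccontr)
  assume less: "\<not> ?thesis"
  define F where "F = \<lparr>pverts = pverts G, parcs = parcs G - {(u, v)}\<rparr>"
  have V: "u \<in> pverts G" "v \<in> pverts G" using wellformed'[OF uv] by auto
  have "parcs G \<subseteq> pverts G \<times> pverts G" using wellformed' by auto
  then have F: "oriented_digraph F"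
    unfolding F_def using verts_nonempty by (intro oriented_digraph_subgraph[OF oriented]) auto
  have mono: "second_nbhd_matrix G x y \<le> second_nbhd_matrix F x y" if "(x, y) \<noteq> (u, v)" for x y
    using that by (intro second_nbhd_matrix_mono[OF oriented F]) (auto simp: F_def)
  show False
  proof (rule no_smaller_weighted_counterexample[OF F])
    show "parcs F \<subset> parcs G" unfolding F_def using uv by auto
    show "weight_vector F w" using w(1) by (simp add: weight_vector_def F_def)
    fix x assume x: "x \<in> pverts F"
    show "second_nbhd_mult F w x > 0"
    proof (cases "x = u")
      case False
      then have "second_nbhd_mult G w x \<le> second_nbhd_mult F w x"
        using w(1) pair_finite_verts
        by (intro second_nbhd_mult_mono mono) (auto simp: F_def)
      with w(2)[of x] x show ?thesis by (auto simp: F_def)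
    next
      case True
      let ?S = "\<lambda>D. \<Sum>y\<in>pverts G - {v}. second_nbhd_matrix D u y * w y"
      have split: "(\<Sum>y\<in>pverts G. second_nbhd_matrix D u y * w y) =
          second_nbhd_matrix D u v * w v + ?S D" for D
        using pair_finite_verts V by (intro sum.remove) auto
      have "?S G \<le> ?S F"
        using w(1) by (intro sum_mono mult_right_mono mono) (auto simp: weight_vector_def)
      moreover have "- w v \<le> second_nbhd_matrix F u v * w v"
        using w(1) V by (auto simp: second_nbhd_matrix_eq[OF F] weight_vector_def)
      moreover have "second_nbhd_matrix G u v = 1"
        using uv by (simp add: second_nbhd_matrix_eq[OF oriented])
      ultimately show ?thesis
        using less split[of G] split[of F] True by (simp add: second_nbhd_mult_def F_def)
    qed
  qed
qed

section \<open>Positivity and the inverse matrix\<close>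

text \<open>
  A vector \<open>w\<close> with a non-positive entry would give a point with a zero entry on the segment
  from \<open>w\<close> to the all-ones vector.
\<close>

lemma pos_if_mult_pos:
  assumes w: "\<And>u. u \<in> pverts G \<Longrightarrow> second_nbhd_mult G w u > 0" and v: "v \<in> pverts G"
  shows "w v > 0"
proof (rule ccontr)
  assume "\<not> w v > 0"
  obtain m where m: "m \<in> pverts G" "\<And>x. x \<in> pverts G \<Longrightarrow> w m \<le> w x"
    using arg_min_if_finite(1)[OF pair_finite_verts verts_nonempty, of w]
      arg_min_least[OF pair_finite_verts verts_nonempty] by blast
  then have wm: "w m \<le> 0" using \<open>\<not> w v > 0\<close> v by fastforce
  \<comment> \<open>The parameter at which the smallest entry, at \<open>m\<close>, reaches
    zero.\<close>
  define t where "t = 1 / (1 - w m)"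
  have t: "0 < t" "t \<le> 1" "t * (1 - w m) = 1" using wm by (auto simp: t_def)
  define w' where "w' = (\<lambda>x. t * w x + (1 - t) * 1)"
  have w'm: "w' m = 0" using t(3) by (simp add: w'_def algebra_simps)
  have "w' m \<le> w' x" if "x \<in> pverts G" for x
    using m(2)[OF that] t(1) by (simp add: w'_def)
  then have "weight_vector G w'" by (simp add: weight_vector_def w'm)
  moreover have "second_nbhd_mult G w' u > 0" if "u \<in> pverts G" for u
    unfolding w'_def second_nbhd_mult_linear
    using t w[OF that] mult_one_pos[OF that] by (intro add_pos_nonneg) auto
  ultimately have "w' m > 0" using weight_pos m(1) by blast
  with w'm show False by simp
qed

text \<open>Adding \<open>e\<close> times the all-ones vector makes the products strictly positive;
  then \<open>e\<close> tends to zero.\<close>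

lemma nonneg_if_mult_nonneg:
  assumes w: "\<And>u. u \<in> pverts G \<Longrightarrow> second_nbhd_mult G w u \<ge> 0" and v: "v \<in> pverts G"
  shows "w v \<ge> 0"
proof (rule field_le_epsilon)
  fix e :: real assume e: "e > 0"
  have "second_nbhd_mult G (\<lambda>x. 1 * w x + e * 1) u > 0" if "u \<in> pverts G" for u
    unfolding second_nbhd_mult_linear using w[OF that] mult_one_pos[OF that] e
    by (intro add_nonneg_pos) auto
  then have "1 * w v + e * 1 > 0" using v by (rule pos_if_mult_pos)
  then show "0 \<le> w v + e" by simp
qed

text \<open>Extends the arc bound to columns of the inverse, whose products may vanish.\<close>

lemma mult_le_twice_weight_if_nonneg:
  assumes w: "\<And>u. u \<in> pverts G \<Longrightarrow> second_nbhd_mult G w u \<ge> 0"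
    and uv: "(u, v) \<in> parcs G"
  shows "second_nbhd_mult G w u \<le> 2 * w v"
proof (rule field_le_epsilon)
  fix e :: real assume e: "e > 0"
  \<comment> \<open>With \<open>e / 2\<close> the bound \<open>2 * w' v\<close> equals
    \<open>2 * w v + e\<close>.\<close>
  define w' where "w' = (\<lambda>x. 1 * w x + (e / 2) * 1)"
  have mult: "second_nbhd_mult G w' x = second_nbhd_mult G w x + (e / 2) * second_nbhd_mult G (\<lambda>_. 1) x" for x
    unfolding w'_def second_nbhd_mult_linear by simp
  have pos: "second_nbhd_mult G w' x > 0" if "x \<in> pverts G" for x
    unfolding mult using w[OF that] mult_one_pos[OF that] e by (intro add_nonneg_pos) auto
  then have "weight_vector G w'"
    using pos_if_mult_pos[of w'] by (auto simp: weight_vector_def less_imp_le)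
  then have "second_nbhd_mult G w' u \<le> 2 * w' v" using pos uv by (rule mult_le_twice_weight)
  moreover have "second_nbhd_mult G w u \<le> second_nbhd_mult G w' u"
    unfolding mult using e mult_one_pos[of u] in_arcsD1[OF uv] by simp
  ultimately show "second_nbhd_mult G w u \<le> 2 * w v + e" by (simp add: w'_def)
qed

text \<open>If the matrix maps \<open>z\<close> to zero, then \<open>z\<close> and its negative are
  both non-negative, so the kernel is trivial. The vector \<open>z u\<close> is column
  \<open>u\<close> of the inverse.\<close>

lemma inverse_columns:
  obtains z where "\<And>u x. x \<in> pverts G \<Longrightarrow> second_nbhd_mult G (z u) x = (if x = u then 1 else 0)"
proof -
  have "\<exists>z. \<forall>x\<in>pverts G. second_nbhd_mult G z x = (if x = u then 1 else 0)" for u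
  proof -
    have "z v = 0" if z: "\<And>x. x \<in> pverts G \<Longrightarrow> (\<Sum>y\<in>pverts G. second_nbhd_matrix G x y * z y) = 0"
      and v: "v \<in> pverts G" for z v
    proof -
      have "second_nbhd_mult G (\<lambda>x. - z x) x = 0" "second_nbhd_mult G z x = 0" if "x \<in> pverts G" for x
        using z[OF that] by (simp_all add: second_nbhd_mult_def sum_negf)
      then have "z v \<ge> 0" "- z v \<ge> 0"
        using nonneg_if_mult_nonneg[OF _ v, of z] nonneg_if_mult_nonneg[OF _ v, of "\<lambda>x. - z x"] by simp_all
      then show ?thesis by simp
    qed
    then obtain z where "\<And>x. x \<in> pverts G \<Longrightarrow>
        (\<Sum>y\<in>pverts G. second_nbhd_matrix G x y * z y) = (if x = u then 1 else 0)"
      using injective_imp_surjective_on_finite[OF pair_finite_verts,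
          of "second_nbhd_matrix G" "\<lambda>x. if x = u then 1 else 0"]
      by blast
    then show ?thesis unfolding second_nbhd_mult_def by blast
  qed
  then show ?thesis using that by metis
qed

section \<open>Degree bounds and the contradiction\<close>

definition succs :: "'a \<Rightarrow> 'a set" where
  "succs u = {v. (u, v) \<in> parcs G}"

definition second_succs :: "'a \<Rightarrow> 'a set" where
  "second_succs u = {v. (u, v) \<notin> parcs G \<and> u \<noteq> v \<and> (\<exists>w. (u, w) \<in> parcs G \<and> (w, v) \<in> parcs G)}"

lemma succs_subset: "succs u \<subseteq> pverts G" and second_succs_subset: "second_succs u \<subseteq> pverts G"
  using wellformed' by (auto simp: succs_def second_succs_def)

lemma finite_succs: "finite (succs u)" and finite_second_succs: "finite (second_succs u)"
  using finite_subset[OF _ pair_finite_verts] succs_subset second_succs_subset by auto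

lemma mult_one: "second_nbhd_mult G (\<lambda>_. 1) u = real (card (succs u)) - real (card (second_succs u))"
proof -
  have "second_nbhd_mult G (\<lambda>_. 1) u =
      (\<Sum>v\<in>pverts G. (if v \<in> succs u then 1 else 0) - (if v \<in> second_succs u then 1 else 0))"
    unfolding second_nbhd_mult_def second_nbhd_matrix_eq[OF oriented]
    by (intro sum.cong) (auto simp: succs_def second_succs_def)
  also have "\<dots> = real (card (pverts G \<inter> succs u)) - real (card (pverts G \<inter> second_succs u))"
    using pair_finite_verts by (simp add: sum_subtractf sum.If_cases)
  finally show ?thesis using succs_subset second_succs_subset by (simp add: Int_absorb1)
qed

lemma card_second_succs_less: "u \<in> pverts G \<Longrightarrow> card (second_succs u) < card (succs u)"
  using mult_one_pos[of u] by (simp add: mult_one)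

text \<open>Row \<open>v\<close> of the inverse is non-negative with sum at most 1, and each
  predecessor of \<open>v\<close> accounts for at least 1/2.\<close>

lemma card_preds_le_2:
  assumes v: "v \<in> pverts G"
  shows "card {u. (u, v) \<in> parcs G} \<le> 2"
proof -
  obtain z where z: "\<And>u x. x \<in> pverts G \<Longrightarrow> second_nbhd_mult G (z u) x = (if x = u then 1 else 0)"
    using inverse_columns by blast
  let ?P = "{u. (u, v) \<in> parcs G}"
  have P: "?P \<subseteq> pverts G" using in_arcsD1 by auto
  have half: "1 / 2 \<le> z u v" if "u \<in> ?P" for u
  proof -
    have "second_nbhd_mult G (z u) u \<le> 2 * z u v"
      using that by (intro mult_le_twice_weight_if_nonneg) (auto simp: z)
    then show ?thesis using z in_arcsD1 that by simp
  qed
  have nonneg: "0 \<le> z u v" for u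
    by (rule nonneg_if_mult_nonneg[OF _ v]) (simp add: z)
  \<comment> \<open>The all-ones vector minus the sum of the columns has non-negative products,
    hence a non-negative entry at \<open>v\<close>.\<close>
  have "1 * 1 + (-1) * (\<Sum>u\<in>pverts G. z u v) \<ge> 0"
  proof (rule nonneg_if_mult_nonneg[OF _ v])
    fix x assume x: "x \<in> pverts G"
    \<comment> \<open>Integrality: a positive difference of two cardinalities is at least 1.\<close>
    have "second_nbhd_mult G (\<lambda>_. 1) x \<ge> 1"
      using card_second_succs_less[OF x] by (simp add: mult_one)
    moreover have "(\<Sum>u\<in>pverts G. second_nbhd_mult G (z u) x) = 1"
      using x pair_finite_verts by (simp add: z)
    ultimately show "0 \<le> second_nbhd_mult G (\<lambda>y. 1 * 1 + (-1) * (\<Sum>u\<in>pverts G. z u y)) x"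
      unfolding second_nbhd_mult_linear second_nbhd_mult_sum by simp
  qed
  moreover have "(\<Sum>u\<in>?P. z u v) \<le> (\<Sum>u\<in>pverts G. z u v)"
    using P nonneg pair_finite_verts by (intro sum_mono2) auto
  moreover have "real (card ?P) * (1 / 2) \<le> (\<Sum>u\<in>?P. z u v)"
    using half by (intro sum_bounded_below) auto
  ultimately show ?thesis by simp
qed

text \<open>Otherwise counting arcs by tails gives at least three per vertex, but by heads at most
  two.\<close>

lemma ex_card_succs_le_2: "\<exists>u\<in>pverts G. card (succs u) \<le> 2"
proof (rule ccontr)
  assume "\<not> ?thesis"
  then have "3 * card (pverts G) \<le> (\<Sum>u\<in>pverts G. card (succs u))"
    using sum_bounded_below[of "pverts G" 3 "\<lambda>u. card (succs u)"] by (force simp: not_le)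
  also have "\<dots> = (\<Sum>u\<in>pverts G. \<Sum>v\<in>pverts G. if (u, v) \<in> parcs G then 1 else 0)"
    using succs_subset pair_finite_verts
    by (intro sum.cong) (simp_all add: sum.If_cases succs_def Int_absorb1)
  also have "\<dots> = (\<Sum>v\<in>pverts G. \<Sum>u\<in>pverts G. if (u, v) \<in> parcs G then 1 else 0)"
    by (rule sum.swap)
  also have "\<dots> = (\<Sum>v\<in>pverts G. card {u. (u, v) \<in> parcs G})"
  proof (intro sum.cong refl)
    fix v
    have "{u. (u, v) \<in> parcs G} \<subseteq> pverts G" using in_arcsD1 by auto
    then show "(\<Sum>u\<in>pverts G. if (u, v) \<in> parcs G then 1 else 0) = card {u. (u, v) \<in> parcs G}"
      using pair_finite_verts by (simp add: sum.If_cases Int_absorb1)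
  qed
  also have "\<dots> \<le> card (pverts G) * 2"
    using sum_bounded_above[of "pverts G" "\<lambda>v. card {u. (u, v) \<in> parcs G}" 2] card_preds_le_2 by simp
  finally have "card (pverts G) = 0" by simp
  then show False using pair_finite_verts verts_nonempty by simp
qed

text \<open>
  Every successor of a vertex \<open>u\<close> of minimal out-degree has a successor among those of \<open>u\<close>,
  which forces \<open>u\<close> to have at least three successors.
\<close>

lemma contradiction: False
proof -
  obtain u where u: "u \<in> pverts G" and least: "\<And>x. x \<in> pverts G \<Longrightarrow> card (succs u) \<le> card (succs x)"
    using arg_min_if_finite(1)[OF pair_finite_verts verts_nonempty, of "\<lambda>x. card (succs x)"]
      arg_min_least[OF pair_finite_verts verts_nonempty, of _ "\<lambda>x. card (succs x)"] by blast
  have le2: "card (succs u) \<le> 2" using ex_card_succs_le_2 least by (meson le_trans)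
  \<comment> \<open>Otherwise all successors of \<open>a\<close> are second successors of
    \<open>u\<close>, so \<open>a\<close> has smaller out-degree than \<open>u\<close>.\<close>
  have step: "\<exists>b\<in>succs u. (a, b) \<in> parcs G" if a: "a \<in> succs u" for a
  proof (rule ccontr)
    assume "\<not> ?thesis"
    then have "succs a \<subseteq> second_succs u"
      using a no_opposite_arcs by (auto simp: succs_def second_succs_def)
    then have "card (succs a) \<le> card (second_succs u)" by (rule card_mono[OF finite_second_succs])
    with card_second_succs_less[OF u] least[of a] a succs_subset[of u] show False by fastforce
  qed
  have "succs u \<noteq> {}" using card_second_succs_less[OF u] by auto
  then obtain a b c where abc: "a \<in> succs u" "b \<in> succs u" "c \<in> succs u"
    "(a, b) \<in> parcs G" "(b, c) \<in> parcs G"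
    using step by (metis all_not_in_conv)
  \<comment> \<open>A loop is its own opposite, and \<open>a = c\<close> would make
    \<open>(a, b)\<close> and \<open>(b, c)\<close> opposite arcs.\<close>
  then have "a \<noteq> b" "b \<noteq> c" "a \<noteq> c" using no_opposite_arcs by auto
  then have "card {a, b, c} = 3" by simp
  moreover have "card {a, b, c} \<le> card (succs u)" using abc by (intro card_mono finite_succs) auto
  ultimately show False using le2 by simp
qed

end

theorem theorem2p7:
  fixes D E :: "'a::infinite pair_pre_digraph"
  assumes "minimal_member X_2_3 D"
    and "minimal_member X_2_1 E"
  shows "num_arcs D < num_arcs E"
proof (rule ccontr)
  assume "\<not> ?thesis"
  \<comment> \<open>Minimality of \<open>D\<close> carries the bound on \<open>E\<close> over to
    every member of \<open>X_2_3\<close>.\<close>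
  then have "num_arcs E \<le> num_arcs F" if "F \<in> X_2_3" for F :: "'a pair_pre_digraph"
    using assms(1) that unfolding minimal_member_def is_arg_min_def by (meson leI order.strict_trans2)
  moreover have "E \<in> X_2_1"
    using assms(2) unfolding minimal_member_def is_arg_min_def by simp
  ultimately have "critical_counterexample E"
    unfolding X_2_1_def critical_counterexample_def critical_counterexample_axioms_def by blast
  then show False by (rule critical_counterexample.contradiction)
qed

end
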